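(* Let $f\colon [0,1]^2 \to \mathbb{R}$ be a continuous function. For every integer $n > 1$ let $$I^n_{i,j} = \left[\tfrac{i-1}{2^n}, \tfrac{i}{2^n}\right[ \times \left[\tfrac{j-1}{2^n}, \tfrac{j}{2^n}\right[, \quad i,j = 1,\ldots,2^n,$$ and define the functions $\underline{f}_n, \overline{f}_n$ on $[0,1[^2$ by $$\underline{f}_n(x,y) = \inf_{(u,v) \in I^n_{i,j}} f(u,v), \qquad \overline{f}_n(x,y) = \sup_{(u,v) \in I^n_{i,j}} f(u,v), \qquad \text{for all } (x,y) \in I^n_{i,j}.$$ Let $\underline{C}^n_{\max}, \overline{C}^n_{\max} \in \mathcal{C}$ be copulas which attain the maxima in $$\max_{C \in \mathcal{C}} \int_{[0,1[^2} \underline{f}_n(x,y)\, dC(x,y) \quad \text{and} \quad \max_{C \in \mathcal{C}} \int_{[0,1[^2} \overline{f}_n(x,y)\, dC(x,y),$$ respectively. Then for every $n > 1$ $$\int_{[0,1[^2} \underline{f}_n(x,y)\, d\underline{C}^n_{\max}(x,y) \leq \sup_{C \in \mathcal{C}} \int_{[0,1[^2} f(x,y)\, dC(x,y) \leq \int_{[0,1[^2} \overline{f}_n(x,y)\, d\overline{C}^n_{\max}(x,y),$$ and $$\lim_{n \to \infty} \int_{[0,1[^2} \underline{f}_n(x,y)\, d\underline{C}^n_{\max}(x,y) = \lim_{n \to \infty} \int_{[0,1[^2} \overline{f}_n(x,y)\, d\overline{C}^n_{\max}(x,y) = \sup_{C \in \mathcal{C}} \int_{[0,1[^2} f(x,y)\,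 dC(x,y).$$
   Context: Half-open intervals are written $[a,b[ = \{x : a \le x < b\}$. A (two-)copula is a nonnegative function $C\colon [0,1]^2 \to \mathbb{R}$ such that for all $x,y \in [0,1]$: $C(x,0) = C(0,y) = 0$, $C(x,1) = x$, $C(1,y) = y$; and for all $x_1 \le x_2$, $y_1 \le y_2$ in $[0,1]$: $C(x_2,y_2) - C(x_2,y_1) - C(x_1,y_2) + C(x_1,y_1) \ge 0$. The set of all two-copulas is denoted $\mathcal{C}$. Equivalently, a copula is the joint distribution function of two random variables each uniformly distributed on the unit interval. The integral $\int_{[0,1[^2} g\, dC$ is the integral of $g$ with respect to the (Lebesgue–Stieltjes) probability measure whose distribution function is $C$. For functions that are constant on each cell $I^n_{i,j}$, the maximum of $\int g\, dC$ over $C \in \mathcal{C}$ is attained, so copulas $\underline{C}^n_{\max}, \overline{C}^n_{\max}$ as described exist. *)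

theory Defs
  imports "HOL-Analysis.Analysis"
begin

text \<open>
  Copulas are functions on the unit square; they are represented by total functions, whose values
  outside the unit square are irrelevant.
\<close>

definition copulas :: "(real \<Rightarrow> real \<Rightarrow> real) set" where
  "copulas = {C.
     (\<forall>x\<in>{0..1}. \<forall>y\<in>{0..1}. C x y \<ge> 0) \<and>
     (\<forall>x\<in>{0..1}. C x 0 = 0 \<and> C x 1 = x) \<and>
     (\<forall>y\<in>{0..1}. C 0 y = 0 \<and> C 1 y = y) \<and>
     (\<forall>x1\<in>{0..1}. \<forall>x2\<in>{0..1}. \<forall>y1\<in>{0..1}. \<forall>y2\<in>{0..1}.
        x1 \<le> x2 \<longrightarrow> y1 \<le> y2 \<longrightarrow> C x2 y2 - C x2 y1 - C x1 y2 + C x1 y1 \<ge> 0)}"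

text \<open>
  The distribution function on the whole plane that a copula determines: arguments are
  projected to the unit interval.
\<close>

definition copula_cdf :: "(real \<Rightarrow> real \<Rightarrow> real) \<Rightarrow> real \<Rightarrow> real \<Rightarrow> real" where
  "copula_cdf C x y = C (max 0 (min 1 x)) (max 0 (min 1 y))"

text \<open>
  The two-dimensional analogue of \<^const>\<open>interval_measure\<close>: the Borel measure on the plane that
  gives each half-open rectangle its increment under the distribution function.
\<close>

definition copula_measure :: "(real \<Rightarrow> real \<Rightarrow> real) \<Rightarrow> (real \<times> real) measure" where
  "copula_measure C =
     extend_measure UNIV {(a, b, c, d). a \<le> b \<and> c \<le> d}
       (\<lambda>(a, b, c, d). {a<..b} \<times> {c<..d})
       (\<lambda>(a, b, c, d). ennreal (copula_cdf C b d - copula_cdf C b c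
                              - copula_cdf C a d + copula_cdf C a c))"

definition copula_integral :: "(real \<Rightarrow> real \<Rightarrow> real) \<Rightarrow> (real \<times> real \<Rightarrow> real) \<Rightarrow> real" where
  "copula_integral C g = set_lebesgue_integral (copula_measure C) ({0..<1} \<times> {0..<1}) g"

definition cell :: "nat \<Rightarrow> nat \<Rightarrow> nat \<Rightarrow> (real \<times> real) set" where
  "cell n i j = {(real i - 1) / 2 ^ n ..< real i / 2 ^ n} \<times> {(real j - 1) / 2 ^ n ..< real j / 2 ^ n}"

end

theory Submission imports Defs begin

text \<open>
  Every copula measure gives the half-open unit square mass at most one
  (\<open>emeasure_copula_measure_unit_square_le\<close>), so \<open>g \<mapsto> \<integral> g dC\<close> is monotone and
  1-Lipschitz for the supremum norm on the square, \<^emph>\<open>uniformly in the copula\<close>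
  (\<open>copula_integral_mono\<close>, \<open>copula_integral_le_add\<close>). Monotonicity and
  \<open>f_low \<le> f \<le> f_up\<close> give the two inequalities. The Lipschitz bound passes to the supremum over
  all copulas: replacing \<open>f\<close> by a function within \<open>e\<close> of it moves the optimal value by at most
  \<open>e\<close> (\<open>copula_max_near_sup\<close>). As \<open>f\<close> is uniformly continuous on the closed square, its
  oscillation on the dyadic cells tends to zero (\<open>eventually_small_oscillation_on_cells\<close>), hence so
  does the distance from \<open>f\<close> to its lower and upper step functions, and both limits follow.

  The estimates use masses of rectangles only through upper bounds. The copula measure is an
  extension of a set function given on rectangles, and each rectangle has at most its prescribed mass
  by the definition of \<^const>\<open>extend_measure\<close>
  (\<open>emeasure_extend_measure_le\<close>).
\<close>

section \<open>Copula measures on the unit square\<close>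

abbreviation unit_square :: "(real \<times> real) set" where
  "unit_square \<equiv> {0..<1} \<times> {0..<1}"

text \<open>
  Either the prescribed values extend to a measure, and equality holds, or
  \<^const>\<open>extend_measure\<close> returns the null measure.
\<close>

lemma emeasure_extend_measure_le:
  assumes "i \<in> I" "G ` I \<subseteq> Pow \<Omega>"
  shows "emeasure (extend_measure \<Omega> I G \<mu>) (G i) \<le> \<mu> i"
proof (cases "\<exists>\<mu>'. (\<forall>i\<in>I. \<mu>' (G i) = \<mu> i) \<and> measure_space \<Omega> (sigma_sets \<Omega> (G ` I)) \<mu>'")
  case True
  then obtain \<mu>' where \<mu>': "\<And>i. i \<in> I \<Longrightarrow> \<mu>' (G i) = \<mu> i"
    and ms: "measure_space \<Omega> (sigma_sets \<Omega> (G ` I)) \<mu>'" by blast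
  have "sets (extend_measure \<Omega> I G \<mu>) = sigma_sets \<Omega> (G ` I)"
    using assms(2) by (simp add: sets_extend_measure)
  then have "emeasure (extend_measure \<Omega> I G \<mu>) (G i) = \<mu> i"
    using ms assms
    by (intro emeasure_extend_measure[where \<mu>' = \<mu>' and \<Omega> = \<Omega> and I = I and G = G, OF refl \<mu>'])
       (simp_all add: measure_space_def)
  then show ?thesis by simp
next
  case False
  then have "extend_measure \<Omega> I G \<mu> = sigma \<Omega> (G ` I)"
    unfolding extend_measure_def by (subst if_not_P) auto
  then show ?thesis by (simp add: emeasure_sigma)
qed

lemma space_copula_measure [simp]: "space (copula_measure C) = UNIV"
  by (simp add: copula_measure_def space_extend_measure)

lemma half_open_rectangle_in_sets_copula_measure:
  assumes "a \<le> b" "c \<le> d"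
  shows "{a<..b} \<times> {c<..d} \<in> sets (copula_measure C)"
proof -
  let ?I = "{(a, b, c, d). a \<le> b \<and> c \<le> d} :: (real \<times> real \<times> real \<times> real) set"
  let ?G = "\<lambda>(a, b, c, d). {a<..b} \<times> {c<..d} :: (real \<times> real) set"
  have "?G (a, b, c, d) \<in> ?G ` ?I"
    using assms by (intro imageI) simp
  then have "?G (a, b, c, d) \<in> sigma_sets UNIV (?G ` ?I)"
    by (rule sigma_sets.Basic)
  then show ?thesis
    by (simp add: copula_measure_def sets_extend_measure)
qed

text \<open>
  Open boxes generate the Borel sets, and each is a countable union of the half-open rectangles
  on which the copula measure is prescribed.
\<close>

lemma borel_subset_sets_copula_measure:
  "sets borel \<subseteq> sets (copula_measure C)"
proof -
  have "box p q \<in> sets (copula_measure C)" for p q :: "real \<times> real"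
  proof -
    obtain a c where p: "p = (a, c)" by (cases p)
    obtain b d where q: "q = (b, d)" by (cases q)
    define R where
      "R k = {a<..max a (b - 1 / real (Suc k))} \<times> {c<..max c (d - 1 / real (Suc k))}" for k
    have "box p q = (\<Union>k. R k)"
    proof (intro equalityI subsetI)
      fix z assume z: "z \<in> box p q"
      obtain x y where xy: "z = (x, y)" by (cases z)
      have less: "a < x" "x < b" "c < y" "y < d"
        using z by (auto simp: p q xy box_def Basis_prod_def)
      obtain k where "inverse (real (Suc k)) < min (b - x) (d - y)"
        using reals_Archimedean[of "min (b - x) (d - y)"] less by auto
      then have "z \<in> R k" using less by (auto simp: R_def xy inverse_eq_divide)
      then show "z \<in> (\<Union>k. R k)" by blast
    next
      fix z assume "z \<in> (\<Union>k. R k)"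
      then obtain k where "z \<in> R k" by blast
      moreover obtain x y where "z = (x, y)" by (cases z)
      ultimately have "a < x" "x \<le> b - 1 / real (Suc k)" "c < y" "y \<le> d - 1 / real (Suc k)"
        unfolding R_def by (auto simp: le_max_iff_disj)
      moreover have "1 / real (Suc k) > 0" by simp
      ultimately have "a < x \<and> x < b \<and> c < y \<and> y < d" by linarith
      with \<open>z = (x, y)\<close> show "z \<in> box p q"
        by (simp add: p q box_def Basis_prod_def)
    qed
    moreover have "R k \<in> sets (copula_measure C)" for k
      unfolding R_def by (intro half_open_rectangle_in_sets_copula_measure) auto
    ultimately show ?thesis by auto
  qed
  then have "range (\<lambda>(p, q). box p q) \<subseteq> sets (copula_measure C)" by auto
  then have "sigma_sets UNIV (range (\<lambda>(p, q). box p q :: (real \<times> real) set))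
      \<subseteq> sets (copula_measure C)"
    using sets.sigma_sets_subset[of _ "copula_measure C"] by simp
  then show ?thesis by (simp add: borel_eq_box)
qed

lemma unit_square_in_sets_copula_measure: "unit_square \<in> sets (copula_measure C)"
  using borel_subset_sets_copula_measure[of C] borel_Times[of "{0..<1::real}" "{0..<1::real}"]
  by auto

text \<open>
  The square itself is not a generator because it is closed on the wrong sides. The generator
  \<open>]-1,1] \<times> ]-1,1]\<close> contains it, and has increment \<open>C 1 1 = 1\<close> because the
  distribution function vanishes at negative arguments.
\<close>

lemma emeasure_copula_measure_unit_square_le:
  assumes "C \<in> copulas"
  shows "emeasure (copula_measure C) unit_square \<le> 1"
proof -
  have "emeasure (copula_measure C) unit_square
      \<le> emeasure (copula_measure C) ({-1<..1} \<times> {-1<..1})"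
    by (intro emeasure_mono half_open_rectangle_in_sets_copula_measure) auto
  also have "\<dots> \<le> ennreal (copula_cdf C 1 1 - copula_cdf C 1 (-1)
                         - copula_cdf C (-1) 1 + copula_cdf C (-1) (-1))"
    using emeasure_extend_measure_le[where i = "(-1, 1, -1, 1)"
        and I = "{(a, b, c, d). a \<le> b \<and> c \<le> d}" and \<Omega> = UNIV
        and G = "\<lambda>(a, b, c, d). {a<..b} \<times> {c<..d}"
        and \<mu> = "\<lambda>(a, b, c, d). ennreal (copula_cdf C b d - copula_cdf C b c
                              - copula_cdf C a d + copula_cdf C a c)"]
    unfolding copula_measure_def by simp
  also have "\<dots> = 1"
    using assms by (auto simp: copula_cdf_def copulas_def)
  finally show ?thesis .
qed

section \<open>The integral as a function of the integrand\<close>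

lemma set_integrable_const_copula_measure:
  fixes c :: real
  assumes "C \<in> copulas" "A \<in> sets (copula_measure C)" "A \<subseteq> unit_square"
  shows "set_integrable (copula_measure C) A (\<lambda>_. c)"
proof -
  have "emeasure (copula_measure C) A \<le> emeasure (copula_measure C) unit_square"
    by (intro emeasure_mono assms unit_square_in_sets_copula_measure)
  also have "\<dots> \<le> 1"
    by (intro emeasure_copula_measure_unit_square_le assms)
  finally have "emeasure (copula_measure C) A < \<infinity>"
    by (simp add: order_le_less_trans)
  then show ?thesis
    unfolding set_integrable_def using assms(2)
    by (intro integrable_scaleR_left integrable_real_indicator) auto
qed

lemma copula_integral_mono:
  assumes "set_integrable (copula_measure C) unit_square g"
    and "set_integrable (copula_measure C) unit_square h"
    and "\<And>p. p \<in> unit_square \<Longrightarrow> g p \<le> h p"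
  shows "copula_integral C g \<le> copula_integral C h"
  unfolding copula_integral_def using assms by (rule set_integral_mono)

lemma copula_integral_le_add:
  assumes "C \<in> copulas" "0 \<le> e"
    and "set_integrable (copula_measure C) unit_square g"
    and "set_integrable (copula_measure C) unit_square h"
    and "\<And>p. p \<in> unit_square \<Longrightarrow> g p \<le> h p + e"
  shows "copula_integral C g \<le> copula_integral C h + e"
proof -
  note const = set_integrable_const_copula_measure[OF assms(1) unit_square_in_sets_copula_measure order_refl]
  have "copula_integral C g \<le> copula_integral C (\<lambda>p. h p + e)"
    using assms const by (intro copula_integral_mono set_integral_add) auto
  also have "\<dots> = copula_integral C h + copula_integral C (\<lambda>_. e)"
    unfolding copula_integral_def using assms const by (intro set_integral_add)
  also have "copula_integral C (\<lambda>_. e) = measure (copula_measure C) unit_square * e"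
    unfolding copula_integral_def set_lebesgue_integral_def
    using unit_square_in_sets_copula_measure[of C] by simp
  also have "\<dots> \<le> 1 * e"
    using emeasure_copula_measure_unit_square_le[OF assms(1)] assms(2)
    by (intro mult_right_mono) (auto simp: measure_def intro: enn2real_leI)
  finally show ?thesis by simp
qed

lemma bounded_image_unit_square:
  fixes f :: "real \<times> real \<Rightarrow> real"
  assumes "continuous_on ({0..1} \<times> {0..1}) f"
  shows "bounded (f ` ({0..1} \<times> {0..1}))"
  by (intro compact_imp_bounded compact_continuous_image assms compact_Times compact_Icc)

lemma set_integrable_continuous_copula_measure:
  assumes "C \<in> copulas" and cont: "continuous_on ({0..1} \<times> {0..1}) f"
  shows "set_integrable (copula_measure C) unit_square (f :: real \<times> real \<Rightarrow> real)"
proof -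
  obtain B where B: "\<And>p. p \<in> {0..1} \<times> {0..1} \<Longrightarrow> \<bar>f p\<bar> \<le> B"
    using bounded_image_unit_square[OF cont] unfolding bounded_iff by auto
  have "(\<lambda>p. indicator unit_square p *\<^sub>R f p) \<in> borel_measurable borel"
    by (rule borel_measurable_continuous_on_indicator)
       (auto intro: borel_Times continuous_on_subset[OF cont])
  then have "(\<lambda>p. indicator unit_square p *\<^sub>R f p) \<in> borel_measurable (copula_measure C)"
    using borel_subset_sets_copula_measure[of C] by (auto simp: measurable_def)
  moreover have "B \<ge> 0" using B[of "(0, 0)"] by simp
  ultimately show ?thesis
    unfolding set_integrable_def
    using B by (intro Bochner_Integration.integrable_bound[OF
        set_integrable_const_copula_measure[OF assms(1) unit_square_in_sets_copula_measure
          order_refl, of B, unfolded set_integrable_def]] AE_I2)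
       (auto simp: indicator_def)
qed

lemma bdd_above_copula_integrals:
  assumes "continuous_on ({0..1} \<times> {0..1}) f"
  shows "bdd_above ((\<lambda>C. copula_integral C f) ` copulas)"
proof -
  obtain B where B: "\<And>p. p \<in> {0..1} \<times> {0..1} \<Longrightarrow> \<bar>f p\<bar> \<le> B"
    using bounded_image_unit_square[OF assms] unfolding bounded_iff by auto
  have "B \<ge> 0" using B[of "(0, 0)"] by simp
  have "copula_integral C f \<le> copula_integral C (\<lambda>_. 0) + B" if "C \<in> copulas" for C
  proof (rule copula_integral_le_add)
    show "f p \<le> 0 + B" if "p \<in> unit_square" for p
      using B[of p] that by (cases p) auto
  qed (use that \<open>B \<ge> 0\<close> assms set_integrable_continuous_copula_measure in auto)
  then have "copula_integral C f \<le> B" if "C \<in> copulas" for C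
    using that by (fastforce simp: copula_integral_def set_lebesgue_integral_def)
  then show ?thesis by (rule bdd_aboveI2)
qed

text \<open>
  The supremum over all copulas inherits the Lipschitz bound, so an exact maximiser for \<open>g\<close>
  nearly attains the supremum for \<open>f\<close>.
\<close>

lemma copula_max_near_sup:
  assumes cont: "continuous_on ({0..1} \<times> {0..1}) f"
    and int: "\<And>C. C \<in> copulas \<Longrightarrow> set_integrable (copula_measure C) unit_square g"
    and max: "is_arg_max (\<lambda>C. copula_integral C g) (\<lambda>C. C \<in> copulas) C0"
    and near: "\<And>p. p \<in> unit_square \<Longrightarrow> \<bar>g p - f p\<bar> \<le> e" and "0 \<le> e"
  shows "\<bar>copula_integral C0 g - (SUP C\<in>copulas. copula_integral C f)\<bar> \<le> e"
proof -
  have C0: "C0 \<in> copulas" and le_max: "\<And>C. C \<in> copulas \<Longrightarrow> copula_integral C g \<le> copula_integral C0 g"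
    using max by (auto simp: is_arg_max_linorder)
  note int_f = set_integrable_continuous_copula_measure[OF _ cont]
  have "copula_integral C0 g \<le> copula_integral C0 f + e"
  proof (intro copula_integral_le_add C0 int int_f \<open>0 \<le> e\<close>)
    show "g p \<le> f p + e" if "p \<in> unit_square" for p
      using near[OF that] by linarith
  qed
  also have "copula_integral C0 f \<le> (SUP C\<in>copulas. copula_integral C f)"
    by (intro cSUP_upper C0 bdd_above_copula_integrals cont)
  finally have 1: "copula_integral C0 g \<le> (SUP C\<in>copulas. copula_integral C f) + e" by simp
  have "copula_integral C f \<le> copula_integral C0 g + e" if C: "C \<in> copulas" for C
  proof -
    have "copula_integral C f \<le> copula_integral C g + e"
    proof (intro copula_integral_le_add C int int_f \<open>0 \<le> e\<close>)
      show "f p \<le> g p + e" if "p \<in> unit_square" for p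
        using near[OF that] by linarith
    qed
    then show ?thesis using le_max[OF C] by simp
  qed
  then have "(SUP C\<in>copulas. copula_integral C f) \<le> copula_integral C0 g + e"
    using C0 by (intro cSUP_least) auto
  with 1 show ?thesis by simp
qed

section \<open>Dyadic cells and step functions\<close>

lemma dyadic_interval_exists:
  fixes x :: real
  assumes "x \<in> {0..<1}"
  shows "\<exists>i\<in>{1..2 ^ n}. x \<in> {(real i - 1) / 2 ^ n ..< real i / 2 ^ n}"
proof (intro bexI)
  let ?k = "nat \<lfloor>x * 2 ^ n\<rfloor>"
  have k: "real ?k \<le> x * 2 ^ n" "x * 2 ^ n < real ?k + 1"
    using assms by auto
  then show "x \<in> {(real (Suc ?k) - 1) / 2 ^ n ..< real (Suc ?k) / 2 ^ n}"
    by (simp add: field_simps)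
  have "x * 2 ^ n < 2 ^ n" using assms by simp
  with k(1) have "real ?k < 2 ^ n" by (rule le_less_trans)
  then have "?k < 2 ^ n" by (metis of_nat_less_iff of_nat_numeral of_nat_power)
  then show "Suc ?k \<in> {1..2 ^ n}" unfolding atLeastAtMost_iff Suc_le_eq by simp
qed

lemma dyadic_interval_subset:
  assumes "i \<in> {1..2 ^ n}"
  shows "{(real i - 1) / 2 ^ n ..< real i / 2 ^ n} \<subseteq> {0..<1}"
proof -
  have "real i \<le> real (2 ^ n)" "1 \<le> real i" using assms by (auto simp del: of_nat_power)
  then have "0 \<le> (real i - 1) / 2 ^ n" "real i / 2 ^ n \<le> 1" by auto
  then show ?thesis by auto
qed

lemma cell_subset_unit_square:
  assumes "i \<in> {1..2 ^ n}" "j \<in> {1..2 ^ n}"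
  shows "cell n i j \<subseteq> unit_square"
  unfolding cell_def by (intro Sigma_mono dyadic_interval_subset assms)

lemma cell_cover:
  assumes "p \<in> unit_square"
  obtains i j where "i \<in> {1..2 ^ n}" "j \<in> {1..2 ^ n}" "p \<in> cell n i j"
  using dyadic_interval_exists[of "fst p" n] dyadic_interval_exists[of "snd p" n] assms
  unfolding cell_def mem_Times_iff by blast

lemma unit_square_eq_UN_cells:
  "unit_square = (\<Union>(i, j)\<in>{1..2 ^ n} \<times> {1..2 ^ n}. cell n i j)"
proof (intro equalityI subsetI)
  fix p assume "p \<in> unit_square"
  then show "p \<in> (\<Union>(i, j)\<in>{1..2 ^ n} \<times> {1..2 ^ n}. cell n i j)"
    by (rule cell_cover[where n = n]) blast
qed (use cell_subset_unit_square in fastforce)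

text \<open>
  Integrability is checked on each of the finitely many cells, where the function is a constant.
\<close>

lemma set_integrable_step_copula_measure:
  fixes g :: "real \<times> real \<Rightarrow> real"
  assumes "C \<in> copulas"
    and step: "\<And>i j p. i \<in> {1..2 ^ n} \<Longrightarrow> j \<in> {1..2 ^ n} \<Longrightarrow> p \<in> cell n i j \<Longrightarrow> g p = c i j"
  shows "set_integrable (copula_measure C) unit_square g"
proof -
  have cell: "cell n i j \<in> sets (copula_measure C)" for i j
    using borel_subset_sets_copula_measure[of C] by (auto simp: cell_def intro!: borel_Times)
  have "set_integrable (copula_measure C) (cell n i j) g"
    if ij: "i \<in> {1..2 ^ n}" "j \<in> {1..2 ^ n}" for i j
  proof -
    have "set_integrable (copula_measure C) (cell n i j) (\<lambda>_. c i j)"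
      by (intro set_integrable_const_copula_measure assms cell cell_subset_unit_square ij)
    then show ?thesis
      using step[OF ij] by (subst set_integrable_cong[OF refl refl]) auto
  qed
  then show ?thesis
    unfolding unit_square_eq_UN_cells[of n] using cell
    by (intro set_integrable_UN) auto
qed

lemma dist_in_cell_le:
  assumes "p \<in> cell n i j" "q \<in> cell n i j"
  shows "dist p q \<le> 2 / 2 ^ n"
proof -
  have "\<bar>x - y\<bar> \<le> 1 / 2 ^ n"
    if "x \<in> {(real k - 1) / 2 ^ n ..< real k / 2 ^ n}"
      and "y \<in> {(real k - 1) / 2 ^ n ..< real k / 2 ^ n}" for x y :: real and k
    using that unfolding diff_divide_distrib abs_le_iff atLeastLessThan_iff by linarith
  then have "dist (fst p) (fst q) \<le> 1 / 2 ^ n" "dist (snd p) (snd q) \<le> 1 / 2 ^ n"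
    using assms by (auto simp: cell_def dist_real_def)
  moreover have "dist p q \<le> dist (fst p) (fst q) + dist (snd p) (snd q)"
    unfolding dist_prod_def by (intro sqrt_sum_squares_le_sum) auto
  ultimately show ?thesis by simp
qed

lemma eventually_small_oscillation_on_cells:
  fixes f :: "real \<times> real \<Rightarrow> real"
  assumes cont: "continuous_on ({0..1} \<times> {0..1}) f" and "e > 0"
  shows "\<forall>\<^sub>F n in sequentially. \<forall>i\<in>{1..2 ^ n}. \<forall>j\<in>{1..2 ^ n}.
           \<forall>p\<in>cell n i j. \<forall>q\<in>cell n i j. \<bar>f p - f q\<bar> \<le> e"
proof -
  have "uniformly_continuous_on ({0..1} \<times> {0..1}) f"
    by (intro compact_uniformly_continuous cont compact_Times compact_Icc)
  then obtain d where "d > 0"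
    and d: "\<And>p q. p \<in> {0..1} \<times> {0..1} \<Longrightarrow> q \<in> {0..1} \<times> {0..1} \<Longrightarrow> dist q p < d
              \<Longrightarrow> dist (f q) (f p) < e"
    using \<open>e > 0\<close> unfolding uniformly_continuous_on_def by metis
  have "(\<lambda>n. 2 * (1 / 2) ^ n :: real) \<longlonglongrightarrow> 2 * 0"
    by (intro tendsto_intros LIMSEQ_realpow_zero) auto
  then have "\<forall>\<^sub>F n in sequentially. 2 * (1 / 2) ^ n < d"
    using \<open>d > 0\<close> by (intro order_tendstoD) auto
  then show ?thesis
  proof eventually_elim
    case (elim n)
    show ?case
    proof (intro ballI)
      fix i j :: nat and p q
      assume ij: "i \<in> {1..2 ^ n}" "j \<in> {1..2 ^ n}" and pq: "p \<in> cell n i j" "q \<in> cell n i j"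
      have "unit_square \<subseteq> {0..1} \<times> {0..1::real}" by auto
      then have "p \<in> {0..1} \<times> {0..1}" "q \<in> {0..1} \<times> {0..1}"
        using cell_subset_unit_square[OF ij] pq by blast+
      moreover have "dist p q < d"
        using dist_in_cell_le[OF pq] elim by (simp add: power_one_over)
      ultimately show "\<bar>f p - f q\<bar> \<le> e"
        using d[of q p] by (simp add: dist_real_def)
    qed
  qed
qed

lemma bounded_image_cell:
  fixes f :: "real \<times> real \<Rightarrow> real"
  assumes cont: "continuous_on ({0..1} \<times> {0..1}) f"
    and "i \<in> {1..2 ^ n}" "j \<in> {1..2 ^ n}"
  shows "bounded (f ` cell n i j)"
proof (rule bounded_subset)
  show "bounded (f ` ({0..1} \<times> {0..1}))"
    by (rule bounded_image_unit_square[OF cont])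
  have "unit_square \<subseteq> {0..1} \<times> {0..1::real}" by auto
  then show "f ` cell n i j \<subseteq> f ` ({0..1} \<times> {0..1})"
    using cell_subset_unit_square[OF assms(2,3)] by (intro image_mono) blast
qed

section \<open>Convergence of the discretised optimal values\<close>

theorem theorem2p2:
  fixes f :: "real \<times> real \<Rightarrow> real"
    and f_low f_up :: "nat \<Rightarrow> real \<times> real \<Rightarrow> real"
    and C_low C_up :: "nat \<Rightarrow> real \<Rightarrow> real \<Rightarrow> real"
  assumes f_cont: "continuous_on ({0..1} \<times> {0..1}) f"
    and f_low: "\<And>n i j p. n > 1 \<Longrightarrow> i \<in> {1..2 ^ n} \<Longrightarrow> j \<in> {1..2 ^ n} \<Longrightarrow> p \<in> cell n i j \<Longrightarrow>
                  f_low n p = (INF q\<in>cell n i j. f q)"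
    and f_up: "\<And>n i j p. n > 1 \<Longrightarrow> i \<in> {1..2 ^ n} \<Longrightarrow> j \<in> {1..2 ^ n} \<Longrightarrow> p \<in> cell n i j \<Longrightarrow>
                  f_up n p = (SUP q\<in>cell n i j. f q)"
    and C_low: "\<And>n. n > 1 \<Longrightarrow>
                  is_arg_max (\<lambda>C. copula_integral C (f_low n)) (\<lambda>C. C \<in> copulas) (C_low n)"
    and C_up: "\<And>n. n > 1 \<Longrightarrow>
                  is_arg_max (\<lambda>C. copula_integral C (f_up n)) (\<lambda>C. C \<in> copulas) (C_up n)"
  shows "(\<forall>n>1. copula_integral (C_low n) (f_low n) \<le> (SUP C\<in>copulas. copula_integral C f) \<and>
                (SUP C\<in>copulas. copula_integral C f) \<le> copula_integral (C_up n) (f_up n)) \<and>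
         (\<lambda>n. copula_integral (C_low n) (f_low n))
           \<longlonglongrightarrow> (SUP C\<in>copulas. copula_integral C f) \<and>
         (\<lambda>n. copula_integral (C_up n) (f_up n))
           \<longlonglongrightarrow> (SUP C\<in>copulas. copula_integral C f)"
proof -
  let ?S = "SUP C\<in>copulas. copula_integral C f"
  note int_f = set_integrable_continuous_copula_measure[OF _ f_cont]
  have int_low: "set_integrable (copula_measure C) unit_square (f_low n)"
    if "n > 1" "C \<in> copulas" for n C
    using that(2) f_low[OF that(1)] by (rule set_integrable_step_copula_measure)
  have int_up: "set_integrable (copula_measure C) unit_square (f_up n)"
    if "n > 1" "C \<in> copulas" for n C
    using that(2) f_up[OF that(1)] by (rule set_integrable_step_copula_measure)

  have low_le: "f_low n p \<le> f p" and le_up: "f p \<le> f_up n p"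
    if n: "n > 1" and p: "p \<in> unit_square" for n p
  proof -
    obtain i j where ij: "i \<in> {1..2 ^ n}" "j \<in> {1..2 ^ n}" "p \<in> cell n i j"
      using p by (rule cell_cover)
    note bdd = bounded_image_cell[OF f_cont ij(1,2)]
    show "f_low n p \<le> f p"
      unfolding f_low[OF n ij] by (intro cINF_lower bounded_imp_bdd_below bdd ij)
    show "f p \<le> f_up n p"
      unfolding f_up[OF n ij] by (intro cSUP_upper bounded_imp_bdd_above bdd ij)
  qed

  have "copula_integral (C_low n) (f_low n) \<le> ?S" if n: "n > 1" for n
  proof -
    have C: "C_low n \<in> copulas" using C_low[OF n] by (simp add: is_arg_max_def)
    have "copula_integral (C_low n) (f_low n) \<le> copula_integral (C_low n) f"
      by (intro copula_integral_mono int_low int_f low_le n C)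
    also have "\<dots> \<le> ?S"
      by (intro cSUP_upper C bdd_above_copula_integrals f_cont)
    finally show ?thesis .
  qed
  moreover have "?S \<le> copula_integral (C_up n) (f_up n)" if n: "n > 1" for n
  proof (rule cSUP_least)
    show "copulas \<noteq> {}" using C_up[OF n] by (auto simp: is_arg_max_def)
    fix C assume C: "C \<in> copulas"
    have "copula_integral C f \<le> copula_integral C (f_up n)"
      by (intro copula_integral_mono int_up int_f le_up n C)
    also have "\<dots> \<le> copula_integral (C_up n) (f_up n)"
      using C_up[OF n] C by (simp add: is_arg_max_linorder)
    finally show "copula_integral C f \<le> copula_integral (C_up n) (f_up n)" .
  qed
  moreover have near: "\<forall>\<^sub>F n in sequentially.
      \<bar>copula_integral (C_low n) (f_low n) - ?S\<bar> \<le> e \<and>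
      \<bar>copula_integral (C_up n) (f_up n) - ?S\<bar> \<le> e" if "e > 0" for e
    using eventually_small_oscillation_on_cells[OF f_cont that] eventually_gt_at_top[of 1]
  proof eventually_elim
    case (elim n)
    then have n: "n > 1" by simp
    have close: "\<bar>f_low n p - f p\<bar> \<le> e \<and> \<bar>f_up n p - f p\<bar> \<le> e" if p: "p \<in> unit_square" for p
    proof -
      obtain i j where ij: "i \<in> {1..2 ^ n}" "j \<in> {1..2 ^ n}" "p \<in> cell n i j"
        using p by (rule cell_cover)
      have osc: "\<bar>f p - f q\<bar> \<le> e" if "q \<in> cell n i j" for q
        using elim ij that by blast
      have "f p - e \<le> f_low n p"
        unfolding f_low[OF n ij] using ij(3) osc
        by (intro cINF_greatest) (force simp: abs_le_iff)+
      moreover have "f_up n p \<le> f p + e"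
        unfolding f_up[OF n ij] using ij(3) osc
        by (intro cSUP_least) (force simp: abs_le_iff)+
      ultimately show ?thesis
        using low_le[OF n p] le_up[OF n p] by simp
    qed
    show ?case
      using close that
      by (intro conjI copula_max_near_sup f_cont int_low int_up C_low C_up n) auto
  qed
  have "(\<lambda>n. copula_integral (C_low n) (f_low n)) \<longlonglongrightarrow> ?S"
  proof (rule tendstoI)
    fix e :: real assume "e > 0"
    from near[of "e / 2"] this show "\<forall>\<^sub>F n in sequentially.
        dist (copula_integral (C_low n) (f_low n)) ?S < e"
      by (auto simp: dist_real_def elim!: eventually_mono)
  qed
  moreover have "(\<lambda>n. copula_integral (C_up n) (f_up n)) \<longlonglongrightarrow> ?S"
  proof (rule tendstoI)
    fix e :: real assume "e > 0"
    from near[of "e / 2"] this show "\<forall>\<^sub>F n in sequentially.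
        dist (copula_integral (C_up n) (f_up n)) ?S < e"
      by (auto simp: dist_real_def elim!: eventually_mono)
  qed
  ultimately show ?thesis by blast
qed

end
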